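(* For every integer $k\ge1$, $$E^{(k-1)(k-2)\cdots1k}_{1\text{-}32}(x)=\begin{cases}e^{e^x}\displaystyle\int_0^x e^{-e^t}\sum_{n\ge k-1}\frac{t^n}{n!}\,dt,&\text{if }k\ge2,\\[2mm] e^{e^x-1},&\text{if }k=1.\end{cases}$$
   Context: A permutation $\pi=\pi_1\cdots\pi_n$ of $\{1,\dots,n\}$ contains the generalized pattern $1\text{-}32$ if there are indices $i<j<n$ such that $\pi_i\pi_j\pi_{j+1}$ is order-isomorphic to $132$; otherwise it avoids it. A permutation $\pi$ begins with a pattern $p=p_1\cdots p_k$ if $n\ge k$ and $\pi_1\cdots\pi_k$ is order-isomorphic to $p$; by convention, the empty permutation is also regarded as beginning with the pattern $1$ (the case $k=1$). The pattern $(k-1)(k-2)\cdots1k$ consists of $k-1,k-2,\dots,1$ in decreasing order followed by $k$ (for $k=1$ it is $1$, for $k=2$ it is $12$). $E^p_q(x)=\sum_{n\ge0}N^p_q(n)\frac{x^n}{n!}$, where $N^p_q(n)$ is the number of permutations of $\{1,\dots,n\}$ that avoid $q$ and begin with $p$. Identities are identities of power series in $x$. *)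

theory Defs
  imports
    Complex_Main
    "HOL-Combinatorics.Multiset_Permutations"
    "HOL-Computational_Algebra.Formal_Power_Series"
begin

text \<open>Permutations of \<open>{1..n}\<close> are written in one-line notation, as the elements of
  \<open>permutations_of_set {1..n}\<close>; list positions are counted from 0.\<close>

definition order_isomorphic :: "nat list \<Rightarrow> nat list \<Rightarrow> bool" where
  "order_isomorphic xs ys \<longleftrightarrow> length xs = length ys \<and>
     (\<forall>i<length xs. \<forall>j<length xs. xs ! i < xs ! j \<longleftrightarrow> ys ! i < ys ! j)"

definition contains_1_32 :: "nat list \<Rightarrow> bool" where
  "contains_1_32 xs \<longleftrightarrow>
     (\<exists>i j. i < j \<and> Suc j < length xs \<and> order_isomorphic [xs ! i, xs ! j, xs ! Suc j] [1, 3, 2])"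

text \<open>The second disjunct is the convention that the empty permutation begins with the
  pattern 1.\<close>

definition begins_with :: "nat list \<Rightarrow> nat list \<Rightarrow> bool" where
  "begins_with xs p \<longleftrightarrow>
     (length p \<le> length xs \<and> order_isomorphic (take (length p) xs) p) \<or> (xs = [] \<and> p = [1])"

definition N_1_32 :: "nat list \<Rightarrow> nat \<Rightarrow> nat" where
  "N_1_32 p n = card {xs \<in> permutations_of_set {1..n}. \<not> contains_1_32 xs \<and> begins_with xs p}"

definition E_1_32 :: "nat list \<Rightarrow> real fps" where
  "E_1_32 p = Abs_fps (\<lambda>n. real (N_1_32 p n) / fact n)"

text \<open>The pattern $(k-1)(k-2)\cdots 1k$.\<close>

definition begin_pattern :: "nat \<Rightarrow> nat list" where
  "begin_pattern k = rev [1..<k] @ [k]"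

text \<open>Formal composition needs an inner series with zero constant term, so the exponential of a
  power series \<open>f\<close> with constant term \<open>c\<close> is taken to be \<open>exp c\<close> times the formal exponential of
  \<open>f - c\<close>. The next two lemmas show that this is the series with constant term \<open>exp c\<close> and
  logarithmic derivative \<open>f'\<close>.\<close>

definition exp_fps :: "real fps \<Rightarrow> real fps" where
  "exp_fps f = fps_const (exp (fps_nth f 0)) * (fps_exp 1 oo (f - fps_const (fps_nth f 0)))"

lemma exp_fps_nth_0: "fps_nth (exp_fps f) 0 = exp (fps_nth f 0)"
  by (simp add: exp_fps_def)

lemma fps_deriv_exp_fps: "fps_deriv (exp_fps f) = fps_deriv f * exp_fps f"
  by (simp add: exp_fps_def fps_compose_deriv mult_ac)

end

theory Submission
  imports Defs "HOL-Library.Infinite_Set"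
begin

text \<open>A permutation \<open>xs 1 ys\<close> avoids 1-32 iff \<open>xs\<close> does and \<open>ys\<close> increases, so it is determined by
  \<open>xs\<close>. It begins with the pattern iff \<open>xs\<close> does, except for the single permutation
  \<open>(k-1) \<dots> 1 k (k+1) \<dots> (n+1)\<close> when \<open>k \<ge> 2\<close>. Hence
  \<open>N (n+1) = (\<Sum>i\<le>n. (n choose i) * N i) + [2 \<le> k \<le> n+1]\<close>, which is the linear differential equation
  \<open>E' = e\<^sup>x E + S\<close>; the integrating factor is \<open>exp (- e\<^sup>x)\<close>.\<close>

section \<open>Invariance under increasing relabelling\<close>

lemma order_isomorphic_map:
  assumes "strict_mono_on A f" "set xs \<subseteq> A"
  shows "order_isomorphic (map f xs) ys \<longleftrightarrow> order_isomorphic xs ys"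
proof -
  have "f (xs ! i) < f (xs ! j) \<longleftrightarrow> xs ! i < xs ! j" if "i < length xs" "j < length xs" for i j
    using that assms strict_mono_on_less by (metis nth_mem subsetD)
  thus ?thesis unfolding order_isomorphic_def by auto
qed

lemma contains_1_32_map:
  assumes "strict_mono_on A f" "set xs \<subseteq> A"
  shows "contains_1_32 (map f xs) \<longleftrightarrow> contains_1_32 xs"
proof -
  have "order_isomorphic [map f xs ! i, map f xs ! j, map f xs ! Suc j] [1, 3, 2] \<longleftrightarrow>
        order_isomorphic [xs ! i, xs ! j, xs ! Suc j] [1, 3, 2]" if "i < j" "Suc j < length xs" for i j
  proof -
    have "set [xs ! i, xs ! j, xs ! Suc j] \<subseteq> A"
      using that assms(2) by (auto simp: subset_iff)
    from order_isomorphic_map[OF assms(1) this] show ?thesis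
      using that by simp
  qed
  thus ?thesis unfolding contains_1_32_def length_map by blast
qed

lemma begins_with_map:
  assumes "strict_mono_on A f" "set xs \<subseteq> A"
  shows "begins_with (map f xs) p \<longleftrightarrow> begins_with xs p"
proof -
  have "set (take (length p) xs) \<subseteq> A"
    using assms(2) set_take_subset by fastforce
  thus ?thesis
    using order_isomorphic_map[OF assms(1)] unfolding begins_with_def by (simp add: take_map)
qed

text \<open>The value set is left arbitrary because the entries preceding the 1 of a permutation can
  form any subset of \<open>{2..Suc n}\<close>.\<close>

definition avoiders :: "nat list \<Rightarrow> nat set \<Rightarrow> nat list set" where
  "avoiders p A = {xs \<in> permutations_of_set A. \<not> contains_1_32 xs \<and> begins_with xs p}"

lemma finite_avoiders: "finite (avoiders p A)"
  unfolding avoiders_def by simp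

lemma N_1_32_eq_card_avoiders: "N_1_32 p n = card (avoiders p {1..n})"
  by (simp add: N_1_32_def avoiders_def)

text \<open>The increasing bijection from \<open>{..<card A}\<close> onto \<open>A\<close>, applied
  entrywise, preserves both avoidance and the initial pattern.\<close>

lemma card_avoiders_initial_segment:
  assumes "finite A"
  shows "card (avoiders p A) = card (avoiders p {..<card A})"
proof -
  obtain f where f: "bij_betw f {..<card A} A" "strict_mono_on {..<card A} f"
    using ex_bij_betw_strict_mono_card[OF assms] by blast
  have inj: "inj_on f {..<card A}" and A: "A = f ` {..<card A}"
    using f(1) by (auto simp: bij_betw_def)
  let ?P = "permutations_of_set {..<card A}"
  have "permutations_of_set A = map f ` ?P"
    using permutations_of_set_image_inj[OF inj] A by simp
  hence "avoiders p A = map f ` {xs \<in> ?P. \<not> contains_1_32 (map f xs) \<and> begins_with (map f xs) p}"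
    unfolding avoiders_def by (simp only:) blast
  also have "{xs \<in> ?P. \<not> contains_1_32 (map f xs) \<and> begins_with (map f xs) p} = avoiders p {..<card A}"
    unfolding avoiders_def
    by (intro Collect_cong conj_cong refl)
       (simp_all add: contains_1_32_map[OF f(2)] begins_with_map[OF f(2)] permutations_of_setD(1))
  finally have "avoiders p A = map f ` avoiders p {..<card A}" .
  moreover have "inj_on (map f) (avoiders p {..<card A})"
    by (intro inj_on_mapI inj_on_subset[OF inj]) (auto simp: avoiders_def dest: permutations_of_setD(1))
  ultimately show ?thesis by (simp add: card_image)
qed

lemma card_avoiders:
  assumes "finite A"
  shows "card (avoiders p A) = N_1_32 p (card A)"
  using card_avoiders_initial_segment[OF assms, of p] card_avoiders_initial_segment[of "{1..card A}" p]
  by (simp add: N_1_32_eq_card_avoiders)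

section \<open>Splitting a permutation at its minimum: avoidance\<close>

lemma contains_1_32_iff:
  "contains_1_32 xs \<longleftrightarrow>
     (\<exists>i j. i < j \<and> Suc j < length xs \<and> xs ! i < xs ! Suc j \<and> xs ! Suc j < xs ! j)"
proof -
  have "order_isomorphic [a, b, c] [1, 3, 2] \<longleftrightarrow> a < c \<and> c < b" for a b c
    unfolding order_isomorphic_def by (auto simp: less_Suc_eq numeral_3_eq_3)
  thus ?thesis unfolding contains_1_32_def by simp
qed

text \<open>Being smallest, \<open>m\<close> can only play the role of 1 in an occurrence, so the
  adjacent pair 32 lies within \<open>xs\<close> or within \<open>ys\<close>. Conversely,
  \<open>m\<close> completes every descent of \<open>ys\<close> to an occurrence.\<close>

lemma contains_1_32_append_min:
  assumes "\<And>x. x \<in> set xs \<union> set ys \<Longrightarrow> m < x"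
  shows "contains_1_32 (xs @ m # ys) \<longleftrightarrow> contains_1_32 xs \<or> \<not> sorted ys"
proof
  let ?zs = "xs @ m # ys" and ?l = "length xs"
  assume "contains_1_32 ?zs"
  then obtain i j where ij: "i < j" "Suc j < length ?zs" "?zs ! i < ?zs ! Suc j" "?zs ! Suc j < ?zs ! j"
    unfolding contains_1_32_iff by blast
  have ge: "m \<le> ?zs ! r" if "r < length ?zs" for r
    using assms nth_mem[OF that] by (force intro: less_imp_le)
  consider "Suc j < ?l" | "Suc j = ?l" | "j = ?l" | "?l < j" by linarith
  thus "contains_1_32 xs \<or> \<not> sorted ys"
  proof cases
    case 1
    thus ?thesis using ij unfolding contains_1_32_iff by (auto simp: nth_append)
  next
    \<comment> \<open>Here \<open>m\<close> would be the 2 of the occurrence, and in the next case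
      the 3; neither is possible for a minimum.\<close>
    case 2
    thus ?thesis using ij ge[of i] by (auto simp: nth_append)
  next
    case 3
    thus ?thesis using ij ge[of "Suc j"] by (auto simp: nth_append)
  next
    case 4
    then obtain r where r: "j = Suc (?l + r)" using less_iff_Suc_add by auto
    have "Suc r < length ys" "ys ! Suc r < ys ! r"
      using ij r by (auto simp: nth_append)
    thus ?thesis using sorted_nth_mono[of ys r "Suc r"] by force
  qed
next
  let ?zs = "xs @ m # ys" and ?l = "length xs"
  assume "contains_1_32 xs \<or> \<not> sorted ys"
  thus "contains_1_32 ?zs"
  proof
    assume "contains_1_32 xs"
    then obtain i j where "i < j" "Suc j < ?l" "xs ! i < xs ! Suc j" "xs ! Suc j < xs ! j"
      unfolding contains_1_32_iff by blast
    thus ?thesis unfolding contains_1_32_iff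
      by (intro exI[of _ i] exI[of _ j]) (auto simp: nth_append)
  next
    assume "\<not> sorted ys"
    then obtain r where "Suc r < length ys" "ys ! Suc r < ys ! r"
      unfolding sorted_iff_nth_Suc by force
    thus ?thesis unfolding contains_1_32_iff using assms
      by (intro exI[of _ ?l] exI[of _ "Suc (?l + r)"]) (auto simp: nth_append)
  qed
qed

section \<open>Splitting a permutation at its minimum: the initial pattern\<close>

lemma length_begin_pattern: "k \<ge> 1 \<Longrightarrow> length (begin_pattern k) = k"
  by (simp add: begin_pattern_def)

lemma nth_begin_pattern:
  "i < k \<Longrightarrow> begin_pattern k ! i = (if i = k - 1 then k else k - 1 - i)"
  by (auto simp: begin_pattern_def nth_append rev_nth)

lemma begins_with_1: "begins_with xs (begin_pattern 1)"
proof (cases xs)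
  case (Cons a list)
  thus ?thesis by (auto simp: begins_with_def begin_pattern_def order_isomorphic_def)
qed (simp add: begins_with_def begin_pattern_def)

lemma begins_with_begin_pattern_iff:
  assumes "k \<ge> 2"
  shows "begins_with xs (begin_pattern k) \<longleftrightarrow> k \<le> length xs \<and>
    (\<forall>i<k. \<forall>j<k. xs ! i < xs ! j \<longleftrightarrow> i < k - 1 \<and> (j = k - 1 \<or> j < i))"
proof -
  have len: "length (begin_pattern k) = k"
    using assms by (simp add: length_begin_pattern)
  \<comment> \<open>This excludes the convention for the empty permutation.\<close>
  have "begin_pattern k \<noteq> [1]"
    using len assms by auto
  moreover have "begin_pattern k ! i < begin_pattern k ! j \<longleftrightarrow> i < k - 1 \<and> (j = k - 1 \<or> j < i)"
    if "i < k" "j < k" for i j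
    using that by (auto simp: nth_begin_pattern)
  ultimately show ?thesis
    using len by (cases "k \<le> length xs") (simp_all add: begins_with_def order_isomorphic_def min_def)
qed

text \<open>For \<open>k \<ge> 2\<close>, the second disjunct is the case of the entry 1 lying among the first \<open>k\<close> entries: it
  must then play the role of the minimum of the pattern, the \<open>(k-1)\<close>-st entry, and since the entries
  after it increase, the \<open>k\<close>-th entry exceeds all earlier ones only if \<open>xs\<close> uses the smallest
  values.\<close>

lemma begins_with_append_min:
  assumes k: "k \<ge> 1" and C: "C \<subseteq> {2..Suc n}" and xs: "distinct xs" "set xs = C"
  shows "begins_with (xs @ 1 # sorted_list_of_set ({2..Suc n} - C)) (begin_pattern k) \<longleftrightarrow>
    begins_with xs (begin_pattern k) \<or> (2 \<le> k \<and> k \<le> Suc n \<and> xs = rev [2..<k])"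
proof (cases "k = 1")
  case True
  thus ?thesis by (simp add: begins_with_1[simplified])
next
  case False
  with k have k2: "k \<ge> 2" by simp
  let ?B = "{2..Suc n} - C"
  let ?zs = "xs @ 1 # sorted_list_of_set ?B"
  note iff = begins_with_begin_pattern_iff[OF k2]
  show ?thesis
  \<comment> \<open>If \<open>xs\<close> has at least \<open>k\<close> entries, the first
    \<open>k\<close> entries of \<open>?zs\<close> are those of \<open>xs\<close>, and
    \<open>rev [2..<k]\<close> is too short to equal \<open>xs\<close>.\<close>
  proof (cases "k \<le> length xs")
    case True
    moreover have "xs \<noteq> rev [2..<k]" using True k2 by auto
    ultimately show ?thesis unfolding iff by (auto simp: nth_append)
  next
    case False
    have "begins_with ?zs (begin_pattern k) \<longleftrightarrow> k \<le> Suc n \<and> xs = rev [2..<k]"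
    proof
      assume "k \<le> Suc n \<and> xs = rev [2..<k]"
      hence kn: "k \<le> Suc n" and xs_eq: "xs = rev [2..<k]" by auto
      have "?B = {k..Suc n}" using xs(2) xs_eq k2 by auto
      hence "sorted_list_of_set ?B = k # [Suc k..<Suc (Suc n)]"
        using kn sorted_list_of_set_range[of k "Suc (Suc n)"]
        by (simp add: atLeastLessThanSuc_atLeastAtMost upt_conv_Cons del: upt_Suc)
      moreover have "[1..<k] = 1 # [2..<k]"
        using k2 by (simp add: upt_conv_Cons numeral_2_eq_2)
      ultimately have "?zs = begin_pattern k @ [Suc k..<Suc (Suc n)]"
        using xs_eq by (simp add: begin_pattern_def del: upt_Suc)
      thus "begins_with ?zs (begin_pattern k)"
        unfolding begins_with_def by (simp add: order_isomorphic_def)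
    next
      assume "begins_with ?zs (begin_pattern k)"
      hence kl: "k \<le> length ?zs"
        and less: "\<And>i j. i < k \<Longrightarrow> j < k \<Longrightarrow> ?zs ! i < ?zs ! j \<longleftrightarrow> i < k - 1 \<and> (j = k - 1 \<or> j < i)"
        unfolding iff by blast+
      have set_zs: "set ?zs \<subseteq> {1..Suc n}" using xs(2) C by auto
      have pos: "1 \<le> ?zs ! r" if "r < k" for r
        using set_zs nth_mem[of r ?zs] that kl by (metis atLeastAtMost_iff less_le_trans subsetD)
      \<comment> \<open>Otherwise the entry 1 would sit at position \<open>k - 1\<close> and would
        have to exceed the first entry.\<close>
      have l1: "length xs \<noteq> k - 1"
        using less[of 0 "k - 1"] pos[of 0] k2 by (auto simp: nth_append)
      \<comment> \<open>Otherwise the pattern would still descend after the entry 1, below the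
        minimum.\<close>
      have "\<not> length xs < k - 2"
      proof
        assume "length xs < k - 2"
        hence "?zs ! Suc (length xs) < ?zs ! length xs"
          using less[of "Suc (length xs)" "length xs"] by auto
        moreover have "1 \<le> ?zs ! Suc (length xs)"
          using \<open>length xs < k - 2\<close> by (intro pos) simp
        moreover have "?zs ! length xs = 1" by simp
        ultimately show False by linarith
      qed
      with l1 False have l: "length xs = k - 2" by linarith
      have card_C: "card C = k - 2" using xs l distinct_card by fastforce
      have "sorted_list_of_set ?B \<noteq> []"
      proof
        assume "sorted_list_of_set ?B = []"
        with kl have "k \<le> Suc (length xs)" by (simp del: sorted_list_of_set_eq_Nil_iff)
        thus False using l k2 by linarith
      qed
      then obtain a as where a: "sorted_list_of_set ?B = a # as" by (cases "sorted_list_of_set ?B") auto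
      have set_as: "set (a # as) = ?B" and sorted_as: "sorted (a # as)"
        unfolding a[symmetric] by simp_all
      have "k - 1 = Suc (length xs)" using l k2 by simp
      hence zs_last: "?zs ! (k - 1) = a" by (simp add: a nth_append)
      have below: "x < a" if "x \<in> C" for x
      proof -
        obtain i where "i < length xs" "x = xs ! i" using \<open>x \<in> C\<close> xs(2) by (metis in_set_conv_nth)
        thus ?thesis using less[of i "k - 1"] zs_last l by (simp add: nth_append)
      qed
      have "a \<in> ?B" using set_as by auto
      \<comment> \<open>\<open>a\<close> exceeds all of \<open>C\<close> and is the least value
        outside it, so \<open>C\<close> fills the gap below \<open>a\<close>; its size
        \<open>k - 2\<close> then forces \<open>a = k\<close>.\<close>
      have "C = {2..<a}"
      proof
        show "C \<subseteq> {2..<a}" using C below by auto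
        show "{2..<a} \<subseteq> C"
        proof
          fix x assume x: "x \<in> {2..<a}"
          show "x \<in> C"
          proof (rule ccontr)
            assume "x \<notin> C"
            hence "x \<in> set (a # as)" using x \<open>a \<in> ?B\<close> unfolding set_as by auto
            thus False using sorted_as x by auto
          qed
        qed
      qed
      moreover have "a = k" using card_C \<open>a \<in> ?B\<close> k2 calculation by auto
      ultimately have C_eq: "C = {2..<k}" and kn: "k \<le> Suc n" using \<open>a \<in> ?B\<close> by auto
      have "xs ! Suc i < xs ! i" if "Suc i < length xs" for i
        using less[of "Suc i" i] that l by (simp add: nth_append)
      hence "sorted (rev xs)"
        unfolding sorted_rev_iff_nth_Suc by (auto intro: less_imp_le)
      hence "rev xs = [2..<k]"
        using xs C_eq by (intro sorted_distinct_set_unique) auto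
      thus "k \<le> Suc n \<and> xs = rev [2..<k]" using kn by (simp add: rev_swap)
    qed
    thus ?thesis using False k2 unfolding iff by auto
  qed
qed

section \<open>The recurrence for the counts\<close>

lemma sum_Pow_card:
  fixes g :: "nat \<Rightarrow> nat"
  assumes "finite B"
  shows "(\<Sum>C\<in>Pow B. g (card C)) = (\<Sum>i\<le>card B. (card B choose i) * g i)"
proof -
  have "(\<Sum>C\<in>Pow B. g (card C)) = (\<Sum>i\<le>card B. \<Sum>C | C \<in> Pow B \<and> card C = i. g (card C))"
    using assms by (intro sum.group[symmetric]) (auto intro: card_mono)
  also have "\<dots> = (\<Sum>i\<le>card B. card {C. C \<subseteq> B \<and> card C = i} * g i)"
    by (intro sum.cong) auto
  finally show ?thesis using n_subsets[OF assms] by simp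
qed

lemma avoiders_decomposition:
  fixes k n :: nat
  assumes k: "k \<ge> 1"
  defines "glue \<equiv> \<lambda>xs. xs @ 1 # sorted_list_of_set ({2..Suc n} - set xs)"
  shows "avoiders (begin_pattern k) {1..Suc n} =
    glue ` ((\<Union>C\<in>Pow {2..Suc n}. avoiders (begin_pattern k) C) \<union>
      (if 2 \<le> k \<and> k \<le> Suc n then {rev [2..<k]} else {}))" (is "?L = glue ` (?U \<union> ?S)")
proof
  show "?L \<subseteq> glue ` (?U \<union> ?S)"
  proof
    fix zs assume zs: "zs \<in> ?L"
    hence set_zs: "set zs = {1..Suc n}" "distinct zs"
      and av: "\<not> contains_1_32 zs" "begins_with zs (begin_pattern k)"
      by (auto simp: avoiders_def dest: permutations_of_setD)
    have "1 \<in> set zs" using set_zs by simp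
    then obtain xs ys where zs_eq: "zs = xs @ 1 # ys" by (meson split_list)
    have "set xs \<union> set ys = {1..Suc n} - {1}" "set xs \<inter> set ys = {}"
      using set_zs unfolding zs_eq by auto
    moreover have "{1..Suc n} - {1} = {2..Suc n}" by auto
    ultimately have sets: "set xs \<union> set ys = {2..Suc n}" "set ys = {2..Suc n} - set xs" by auto
    have "1 < x" if "x \<in> set xs \<union> set ys" for x using that unfolding sets(1) by simp
    hence av': "\<not> contains_1_32 xs" "sorted ys"
      using av(1) contains_1_32_append_min[of xs ys 1] unfolding zs_eq by auto
    have "ys = sorted_list_of_set ({2..Suc n} - set xs)"
      using av'(2) sets set_zs(2) unfolding zs_eq
      by (intro sorted_distinct_set_unique) auto
    hence glue: "zs = glue xs" unfolding glue_def zs_eq by simp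
    have sub: "set xs \<subseteq> {2..Suc n}" using sets by auto
    have dist: "distinct xs" using set_zs(2) zs_eq by simp
    have "begins_with xs (begin_pattern k) \<or> (2 \<le> k \<and> k \<le> Suc n \<and> xs = rev [2..<k])"
      using av(2) begins_with_append_min[OF k sub dist refl] unfolding glue glue_def by simp
    hence "xs \<in> ?U \<union> ?S"
    proof
      assume "begins_with xs (begin_pattern k)"
      hence "xs \<in> avoiders (begin_pattern k) (set xs)"
        using av'(1) dist by (auto simp: avoiders_def intro: permutations_of_setI)
      thus ?thesis using sub by blast
    qed simp
    thus "zs \<in> glue ` (?U \<union> ?S)" using glue by blast
  qed
  show "glue ` (?U \<union> ?S) \<subseteq> ?L"
  proof
    fix zs assume "zs \<in> glue ` (?U \<union> ?S)"
    then obtain xs where xs: "xs \<in> ?U \<union> ?S" and zs: "zs = glue xs" by blast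
    have props: "set xs \<subseteq> {2..Suc n} \<and> distinct xs \<and> \<not> contains_1_32 xs \<and>
      (begins_with xs (begin_pattern k) \<or> (2 \<le> k \<and> k \<le> Suc n \<and> xs = rev [2..<k]))"
      using xs
    proof
      assume "xs \<in> ?S"
      hence xs_eq: "xs = rev [2..<k]" and k2: "2 \<le> k" "k \<le> Suc n" by (auto split: if_splits)
      \<comment> \<open>A decreasing list has no ascending pair to serve as 1 and 2.\<close>
      have "\<not> contains_1_32 xs"
        unfolding contains_1_32_iff xs_eq by (auto simp: rev_nth)
      thus ?thesis using xs_eq k2 by auto
    qed (auto simp: avoiders_def dest: permutations_of_setD)
    let ?ys = "sorted_list_of_set ({2..Suc n} - set xs)"
    have "\<not> contains_1_32 (xs @ 1 # ?ys)"
      using props by (subst contains_1_32_append_min) auto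
    moreover have "begins_with (xs @ 1 # ?ys) (begin_pattern k)"
      using begins_with_append_min[OF k, of "set xs" n xs] props by blast
    moreover have "xs @ 1 # ?ys \<in> permutations_of_set {1..Suc n}"
      using props by (intro permutations_of_setI) auto
    ultimately show "zs \<in> ?L" unfolding zs glue_def avoiders_def by blast
  qed
qed

lemma N_1_32_Suc:
  assumes k: "k \<ge> 1"
  shows "N_1_32 (begin_pattern k) (Suc n) =
    (\<Sum>i\<le>n. (n choose i) * N_1_32 (begin_pattern k) i) + (if 2 \<le> k \<and> k \<le> Suc n then 1 else 0)"
proof -
  let ?p = "begin_pattern k"
  let ?U = "\<Union>C\<in>Pow {2..Suc n}. avoiders ?p C"
  let ?S = "if 2 \<le> k \<and> k \<le> Suc n then {rev [2..<k]} else {}"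
  let ?glue = "\<lambda>xs. xs @ 1 # sorted_list_of_set ({2..Suc n} - set xs)"
  have "inj_on ?glue (?U \<union> ?S)"
  proof (rule inj_onI)
    fix xs ys assume xy: "xs \<in> ?U \<union> ?S" "ys \<in> ?U \<union> ?S" and eq: "?glue xs = ?glue ys"
    have "1 \<notin> set zs" if "zs \<in> ?U \<union> ?S" for zs
      using that by (auto simp: avoiders_def dest: permutations_of_setD split: if_splits)
    \<comment> \<open>The prefix is recovered by cutting at the entry 1, so \<open>?glue\<close> is
      injective on lists without 1.\<close>
    moreover have "takeWhile (\<lambda>x. x \<noteq> 1) (?glue zs) = zs" if "1 \<notin> set zs" for zs
      using that by (subst takeWhile_append2) auto
    ultimately show "xs = ys" using xy eq by metis
  qed
  hence "N_1_32 ?p (Suc n) = card (?U \<union> ?S)"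
    unfolding N_1_32_eq_card_avoiders avoiders_decomposition[OF k] by (rule card_image)
  also have "\<dots> = card ?U + card ?S"
  proof (rule card_Un_disjoint)
    \<comment> \<open>The exceptional prefix has only \<open>k - 2\<close> entries, too few to begin
      with the pattern itself.\<close>
    show "?U \<inter> ?S = {}"
      using begins_with_begin_pattern_iff[of k "rev [2..<k]"] by (auto simp: avoiders_def)
  qed (auto simp: finite_avoiders)
  also have "card ?U = (\<Sum>C\<in>Pow {2..Suc n}. card (avoiders ?p C))"
    by (rule card_UN_disjoint)
       (auto simp: finite_avoiders, auto simp: avoiders_def dest: permutations_of_setD)
  also have "\<dots> = (\<Sum>C\<in>Pow {2..Suc n}. N_1_32 ?p (card C))"
    by (intro sum.cong refl card_avoiders) (auto intro: finite_subset)
  also have "\<dots> = (\<Sum>i\<le>n. (n choose i) * N_1_32 ?p i)"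
    using sum_Pow_card[of "{2..Suc n}"] by simp
  finally show ?thesis by simp
qed

lemma N_1_32_0: "k \<ge> 1 \<Longrightarrow> N_1_32 (begin_pattern k) 0 = (if k \<ge> 2 then 0 else 1)"
proof -
  assume k: "k \<ge> 1"
  have "\<not> contains_1_32 []" by (simp add: contains_1_32_iff)
  moreover have "begins_with [] (begin_pattern k) \<longleftrightarrow> \<not> k \<ge> 2"
  proof (cases "k \<ge> 2")
    case True
    thus ?thesis using begins_with_begin_pattern_iff[of k "[]"] by simp
  next
    case False
    hence "k = 1" using k by simp
    thus ?thesis using begins_with_1[of "[]"] by simp
  qed
  ultimately have "avoiders (begin_pattern k) {1..0} = (if k \<ge> 2 then {} else {[]})"
    by (auto simp: avoiders_def)
  thus ?thesis by (simp add: N_1_32_eq_card_avoiders)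
qed

section \<open>The differential equation and its solution\<close>

text \<open>The binomial convolution in the recurrence becomes the product with
  \<open>fps_exp 1\<close>; the exceptional permutation, present exactly when
  \<open>n \<ge> k - 1\<close>, gives the inhomogeneous term.\<close>

lemma fps_deriv_E_1_32:
  assumes k: "k \<ge> 1"
  shows "fps_deriv (E_1_32 (begin_pattern k)) = fps_exp 1 * E_1_32 (begin_pattern k) +
    (if k \<ge> 2 then Abs_fps (\<lambda>n. if n \<ge> k - 1 then 1 / fact n else 0) else 0)"
proof (rule fps_ext)
  fix n
  let ?N = "N_1_32 (begin_pattern k)"
  have "(\<Sum>i\<le>n. real (n choose i) * real (?N i)) / fact n =
      (\<Sum>i\<le>n. real (?N i) / fact i * (1 / fact (n - i)))"
    unfolding sum_divide_distrib by (intro sum.cong refl) (simp add: binomial_fact)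
  hence conv: "fps_nth (fps_exp 1 * E_1_32 (begin_pattern k)) n =
      (\<Sum>i\<le>n. real (n choose i) * real (?N i)) / fact n"
    by (simp add: mult.commute[of "fps_exp 1"] E_1_32_def fps_mult_nth atLeast0AtMost)
  have "fps_nth (fps_deriv (E_1_32 (begin_pattern k))) n = real (?N (Suc n)) / fact n"
    by (simp add: E_1_32_def del: of_nat_Suc)
  also have "\<dots> = (\<Sum>i\<le>n. real (n choose i) * real (?N i)) / fact n +
      (if 2 \<le> k \<and> k \<le> Suc n then 1 / fact n else 0)"
    unfolding N_1_32_Suc[OF k] by (simp add: add_divide_distrib)
  finally show "fps_nth (fps_deriv (E_1_32 (begin_pattern k))) n =
      fps_nth (fps_exp 1 * E_1_32 (begin_pattern k) +
        (if k \<ge> 2 then Abs_fps (\<lambda>n. if n \<ge> k - 1 then 1 / fact n else 0) else 0)) n"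
    by (auto simp: conv)
qed

text \<open>The product has derivative 0, and its constant term is
  \<open>exp c * exp (- c) = 1\<close>, where \<open>c\<close> is the constant term of
  \<open>g\<close>.\<close>

lemma exp_fps_mult_uminus: "exp_fps g * exp_fps (- g) = 1"
proof -
  have "fps_deriv (exp_fps g * exp_fps (- g)) = 0"
    by (simp add: fps_deriv_exp_fps algebra_simps)
  hence "exp_fps g * exp_fps (- g) = fps_const (fps_nth (exp_fps g * exp_fps (- g)) 0)"
    using fps_deriv_eq_0_iff by blast
  thus ?thesis by (simp add: exp_fps_nth_0 exp_minus)
qed

text \<open>The integrating factor \<open>exp_fps (- g)\<close> turns the difference of two
  solutions into a constant, which the common initial value makes 0; the factor itself is nonzero
  and cancels.\<close>

lemma fps_linear_ode_unique:
  fixes F G g r :: "real fps"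
  assumes "fps_deriv F = fps_deriv g * F + r" "fps_deriv G = fps_deriv g * G + r" "fps_nth F 0 = fps_nth G 0"
  shows "F = G"
proof -
  have "fps_deriv ((F - G) * exp_fps (- g)) = 0"
    by (simp add: assms fps_deriv_exp_fps algebra_simps)
  hence "(F - G) * exp_fps (- g) = fps_const (fps_nth ((F - G) * exp_fps (- g)) 0)"
    using fps_deriv_eq_0_iff by blast
  hence "(F - G) * exp_fps (- g) = 0" using assms(3) by simp
  moreover have "exp_fps (- g) \<noteq> 0" using exp_fps_mult_uminus[of g] by auto
  ultimately show ?thesis by simp
qed

theorem proposition22:
  fixes k :: nat
  assumes "k \<ge> 1"
  shows "E_1_32 (begin_pattern k) =
    (if k \<ge> 2 then
       exp_fps (fps_exp 1) *
         fps_integral0 (exp_fps (- fps_exp 1) * Abs_fps (\<lambda>n. if n \<ge> k - 1 then 1 / fact n else 0))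
     else exp_fps (fps_exp 1 - 1))"
proof -
  let ?S = "Abs_fps (\<lambda>n. if n \<ge> k - 1 then 1 / fact n else 0) :: real fps"
  let ?R = "exp_fps (fps_exp 1) * fps_integral0 (exp_fps (- fps_exp 1) * ?S)"
  have E: "fps_deriv (E_1_32 (begin_pattern k)) =
      fps_deriv (fps_exp 1) * E_1_32 (begin_pattern k) + (if k \<ge> 2 then ?S else 0)"
    using fps_deriv_E_1_32[OF assms] by simp
  have E0: "fps_nth (E_1_32 (begin_pattern k)) 0 = (if k \<ge> 2 then 0 else 1)"
    by (simp add: E_1_32_def N_1_32_0[OF assms])
  show ?thesis
  proof (cases "k \<ge> 2")
    case True
    \<comment> \<open>Variation of constants: differentiating the integral leaves mutually inverse
      exponentials in front of \<open>?S\<close>.\<close>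
    have "fps_deriv ?R = fps_deriv (fps_exp 1) * ?R + exp_fps (fps_exp 1) * exp_fps (- fps_exp 1) * ?S"
      by (simp add: fps_deriv_exp_fps fps_deriv_fps_integral algebra_simps)
    hence R: "fps_deriv ?R = fps_deriv (fps_exp 1) * ?R + ?S"
      by (simp only: exp_fps_mult_uminus mult_1_left)
    have "E_1_32 (begin_pattern k) = ?R"
    proof (rule fps_linear_ode_unique)
      show "fps_deriv (E_1_32 (begin_pattern k)) =
          fps_deriv (fps_exp 1) * E_1_32 (begin_pattern k) + ?S"
        using E True by (simp only: if_True)
      show "fps_nth (E_1_32 (begin_pattern k)) 0 = fps_nth ?R 0"
        using E0 True by simp
    qed (fact R)
    thus ?thesis using True by simp
  next
    case False
    \<comment> \<open>For \<open>k = 1\<close> the equation is homogeneous; subtracting 1 in the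
      exponent makes the constant term \<open>exp 0 = 1\<close>, matching the empty
      permutation.\<close>
    have "E_1_32 (begin_pattern k) = exp_fps (fps_exp 1 - 1)"
    proof (rule fps_linear_ode_unique)
      show "fps_deriv (E_1_32 (begin_pattern k)) =
          fps_deriv (fps_exp 1) * E_1_32 (begin_pattern k) + 0"
        using E False by simp
    qed (use E0 False in \<open>simp_all add: fps_deriv_exp_fps exp_fps_nth_0\<close>)
    thus ?thesis using False by simp
  qed
qed

end
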